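(* Let $S_0\subset\Delta$, $w\in W$ with $wS_0\subset R_+$, and $S=wS_0$. If $\beta\in\Delta$ and $\beta\notin S$, then $\beta$ is not a linear combination (with complex coefficients) of the elements of $S$.
   Context: $R$ is an irreducible reduced root system in $V=\mathbb C^n$ with Weyl group $W$, positive roots $R_+$ and set of simple roots $\Delta$. *)

theory Defs
  imports "HOL-Analysis.Analysis"
begin

text \<open>Root systems in V = complex^'n, following Bourbaki (no inner product needed):
  a reflection for a root a is a map x \<mapsto> x - f(x) a with f a C-linear functional
  (the coroot) with f(a) = 2, preserving R, and f(b) integral for all roots b.\<close>

definition root_reflection ::
  "(complex ^ 'n) set \<Rightarrow> complex ^ 'n \<Rightarrow> (complex ^ 'n \<Rightarrow> complex ^ 'n) \<Rightarrow> bool" where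
  "root_reflection R a s \<longleftrightarrow>
     (\<exists>f :: complex ^ 'n \<Rightarrow> complex.
        Vector_Spaces.linear (*s) (*) f \<and> f a = 2 \<and>
        s = (\<lambda>x. x - f x *s a) \<and> s ` R = R \<and> (\<forall>b\<in>R. f b \<in> \<int>))"

definition root_system :: "(complex ^ 'n) set \<Rightarrow> bool" where
  "root_system R \<longleftrightarrow> finite R \<and> 0 \<notin> R \<and> vec.span R = UNIV \<and>
     (\<forall>a\<in>R. \<exists>s. root_reflection R a s)"

definition reduced_root_system :: "(complex ^ 'n) set \<Rightarrow> bool" where
  "reduced_root_system R \<longleftrightarrow> root_system R \<and>
     (\<forall>a\<in>R. \<forall>c::complex. c *s a \<in> R \<longrightarrow> c = 1 \<or> c = -1)"

text \<open>Irreducible: R is not the union of two nonempty disjoint subsets that are mutually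
  orthogonal, i.e. whose reflections fix each other's roots.\<close>
definition irreducible_root_system :: "(complex ^ 'n) set \<Rightarrow> bool" where
  "irreducible_root_system R \<longleftrightarrow> root_system R \<and>
     \<not> (\<exists>R1 R2. R1 \<noteq> {} \<and> R2 \<noteq> {} \<and> R1 \<inter> R2 = {} \<and> R = R1 \<union> R2 \<and>
          (\<forall>a\<in>R1. \<forall>b\<in>R2. \<forall>s. root_reflection R a s \<longrightarrow> s b = b))"

text \<open>A base (set of simple roots): a linearly independent subset of R such that every
  root is an integer combination of it with all coefficients \<ge> 0 or all \<le> 0.\<close>
definition root_base :: "(complex ^ 'n) set \<Rightarrow> (complex ^ 'n) set \<Rightarrow> bool" where
  "root_base R D \<longleftrightarrow> D \<subseteq> R \<and> vec.independent D \<and>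
     (\<forall>b\<in>R. \<exists>k :: complex ^ 'n \<Rightarrow> int.
        b = (\<Sum>d\<in>D. of_int (k d) *s d) \<and> ((\<forall>d\<in>D. k d \<ge> 0) \<or> (\<forall>d\<in>D. k d \<le> 0)))"

definition positive_roots :: "(complex ^ 'n) set \<Rightarrow> (complex ^ 'n) set \<Rightarrow> (complex ^ 'n) set" where
  "positive_roots R D = {b\<in>R. \<exists>k :: complex ^ 'n \<Rightarrow> int.
        b = (\<Sum>d\<in>D. of_int (k d) *s d) \<and> (\<forall>d\<in>D. k d \<ge> 0)}"

text \<open>Weyl group: generated by the root reflections.\<close>
inductive_set weyl_group :: "(complex ^ 'n) set \<Rightarrow> (complex ^ 'n \<Rightarrow> complex ^ 'n) set"
  for R where
  weyl_id: "id \<in> weyl_group R"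
| weyl_step: "w \<in> weyl_group R \<Longrightarrow> a \<in> R \<Longrightarrow> root_reflection R a s \<Longrightarrow> s \<circ> w \<in> weyl_group R"

end

theory Submission
  imports Defs
begin

(* Proof idea.  Suppose the simple root beta lies in the span of S = w S0.  Every element of
   the Weyl group is a linear bijection of the ambient space permuting the roots, so
   x = w^-1 beta is a root in the span of S0.  Since S0 is a subset of the base D, the
   coordinates of x with respect to D vanish outside S0, hence x is a sign-coherent integer
   combination of S0, and applying w gives beta = sum_e k_e * w(e) with all k_e of one sign.
   Each w(e) is a positive root, i.e. a nonzero vector with nonnegative integer coordinates;
   comparing coordinates with respect to D, the unit vector of beta would be a sign-coherent
   integer combination of nonzero nonnegative integer vectors, which forces one of them to be
   that unit vector itself.  Hence beta = w(e) for some e in S0, contradicting beta not in S. *)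

text \<open>A linear injection of the ambient space that permutes the roots.\<close>
definition root_automorphism ::
  "(complex ^ 'n) set \<Rightarrow> (complex ^ 'n \<Rightarrow> complex ^ 'n) \<Rightarrow> bool" where
  "root_automorphism R w \<longleftrightarrow> Vector_Spaces.linear (*s) (*s) w \<and> inj w \<and> w ` R = R"

text \<open>A root reflection is linear, an involution (hence injective), and preserves the roots.\<close>
lemma root_reflection_automorphism:
  assumes "root_reflection R a s"
  shows "root_automorphism R s"
proof -
  obtain f where f_linear: "Vector_Spaces.linear (*s) (*) f" and f_a: "f a = 2"
    and s_def: "s = (\<lambda>x. x - f x *s a)" and s_R: "s ` R = R"
    using assms unfolding root_reflection_def by blast
  have f_add: "f (x + y) = f x + f y" and f_scale: "f (c *s x) = c * f x" for x y c
    using f_linear by (simp_all add: Vector_Spaces.linear_iff vec.vector_space_axioms)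
  have s_linear: "Vector_Spaces.linear (*s) (*s) s"
    by (auto simp: Vector_Spaces.linear_iff vec.vector_space_axioms s_def f_add f_scale
        algebra_simps vec.scale_left_distrib vec.scale_scale)
  have "s (s x) = x" for x
  proof -
    have "f (s x) = - f x"
      using f_add[of x "- (f x *s a)"] f_scale[of "- f x" a] f_a by (simp add: s_def)
    then show ?thesis by (simp add: s_def vec.scale_left_diff_distrib)
  qed
  then have "inj s" by (metis injI)
  with s_linear s_R show ?thesis by (simp add: root_automorphism_def)
qed

text \<open>Automorphisms are closed under composition, so the whole Weyl group consists of them.\<close>
lemma weyl_group_automorphism:
  assumes "w \<in> weyl_group R"
  shows "root_automorphism R w"
  using assms
proof induction
  case weyl_id
  show ?case by (simp add: root_automorphism_def Vector_Spaces.linear_iff vec.vector_space_axioms)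
next
  case (weyl_step w a s)
  have "root_automorphism R s" using weyl_step.hyps(3) by (rule root_reflection_automorphism)
  with weyl_step.IH show ?case
    unfolding root_automorphism_def
    by (metis Vector_Spaces.linear_compose inj_compose image_comp)
qed

text \<open>Coordinates with respect to a finite independent set recover the coefficients.\<close>
lemma representation_of_combination:
  fixes D :: "(complex ^ 'n) set"
  assumes "vec.independent D" "finite D" "d \<in> D"
  shows "vec.representation D (\<Sum>e\<in>D. c e *s e) d = c d"
  using assms
  by (simp add: vec.representation_sum vec.representation_scale vec.span_base
      vec.span_scale vec.representation_basis if_distrib cong: if_cong)

text \<open>A root lying in the span of a set of simple roots is a sign-coherent integer
  combination of exactly those simple roots: its other coordinates vanish.\<close>
lemma root_in_span_of_simple_roots:
  assumes base: "root_base R D" and "finite D" and "S \<subseteq> D"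
    and "x \<in> R" and "x \<in> vec.span S"
  shows "\<exists>k :: complex ^ 'n \<Rightarrow> int. x = (\<Sum>e\<in>S. of_int (k e) *s e) \<and>
           ((\<forall>e\<in>S. k e \<ge> 0) \<or> (\<forall>e\<in>S. k e \<le> 0))"
proof -
  have indep: "vec.independent D" using base by (simp add: root_base_def)
  obtain k :: "complex ^ 'n \<Rightarrow> int" where x_D: "x = (\<Sum>d\<in>D. of_int (k d) *s d)"
    and k_sign: "(\<forall>d\<in>D. k d \<ge> 0) \<or> (\<forall>d\<in>D. k d \<le> 0)"
    using base \<open>x \<in> R\<close> by (auto simp: root_base_def)
  have k_outside: "k d = 0" if "d \<in> D - S" for d
  proof -
    have "of_int (k d) = vec.representation D x d"
      using representation_of_combination[OF indep \<open>finite D\<close>] that by (simp add: x_D)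
    also have "\<dots> = vec.representation S x d"
      using vec.representation_extend[OF indep \<open>x \<in> vec.span S\<close> \<open>S \<subseteq> D\<close>] by simp
    also have "\<dots> = 0"
      using vec.representation_ne_zero[of S x d] that by blast
    finally show ?thesis by simp
  qed
  have "x = (\<Sum>e\<in>S. of_int (k e) *s e)"
    unfolding x_D using \<open>finite D\<close> \<open>S \<subseteq> D\<close> k_outside
    by (intro sum.mono_neutral_left[symmetric]) auto
  with k_sign \<open>S \<subseteq> D\<close> show ?thesis by blast
qed

text \<open>The arithmetic core: a unit vector of integer coordinates is not a sign-coherent
  integer combination of nonzero nonnegative integer vectors unless it is one of them.\<close>
lemma unit_vector_indecomposable:
  fixes k :: "'a \<Rightarrow> int" and m :: "'a \<Rightarrow> 'b \<Rightarrow> int"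
  assumes "finite S" and "\<beta> \<in> D"
    and m_nonneg: "\<And>e d. e \<in> S \<Longrightarrow> d \<in> D \<Longrightarrow> m e d \<ge> 0"
    and m_nonzero: "\<And>e. e \<in> S \<Longrightarrow> \<exists>d\<in>D. m e d \<noteq> 0"
    and k_sign: "(\<forall>e\<in>S. k e \<ge> 0) \<or> (\<forall>e\<in>S. k e \<le> 0)"
    and sum_unit: "\<And>d. d \<in> D \<Longrightarrow> (\<Sum>e\<in>S. k e * m e d) = (if d = \<beta> then 1 else 0)"
  shows "\<exists>e\<in>S. \<forall>d\<in>D. m e d = (if d = \<beta> then 1 else 0)"
proof -
  have sum_at_\<beta>: "(\<Sum>e\<in>S. k e * m e \<beta>) = 1" using sum_unit[OF \<open>\<beta> \<in> D\<close>] by simp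
  have k_nonneg: "\<forall>e\<in>S. k e \<ge> 0"
  proof (rule ccontr)
    assume "\<not> (\<forall>e\<in>S. k e \<ge> 0)"
    with k_sign have "(\<Sum>e\<in>S. k e * m e \<beta>) \<le> 0"
      using m_nonneg \<open>\<beta> \<in> D\<close> by (auto intro!: sum_nonpos simp: mult_nonpos_nonneg)
    with sum_at_\<beta> show False by simp
  qed
  obtain e0 where e0: "e0 \<in> S" "k e0 > 0"
  proof -
    have "\<exists>e\<in>S. k e \<noteq> 0"
    proof (rule ccontr)
      assume "\<not> (\<exists>e\<in>S. k e \<noteq> 0)"
      then have "(\<Sum>e\<in>S. k e * m e \<beta>) = 0" by simp
      with sum_at_\<beta> show False by simp
    qed
    with k_nonneg that show thesis by force
  qed
  have term_le: "k e0 * m e0 d \<le> (if d = \<beta> then 1 else 0)" if "d \<in> D" for d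
  proof -
    have "k e0 * m e0 d \<le> (\<Sum>e\<in>S. k e * m e d)"
      using \<open>finite S\<close> e0(1) k_nonneg m_nonneg \<open>d \<in> D\<close> by (intro member_le_sum) auto
    with sum_unit[OF \<open>d \<in> D\<close>] show ?thesis by simp
  qed
  have off_\<beta>: "m e0 d = 0" if "d \<in> D" "d \<noteq> \<beta>" for d
    using term_le[OF that(1)] that(2) e0(2) m_nonneg[OF e0(1) that(1)]
    by (smt (verit) mult_pos_pos)
  have "m e0 \<beta> \<noteq> 0" using m_nonzero[OF e0(1)] off_\<beta> by blast
  then have "1 \<le> m e0 \<beta>" using m_nonneg[OF e0(1) \<open>\<beta> \<in> D\<close>] by simp
  moreover have "m e0 \<beta> \<le> k e0 * m e0 \<beta>" using e0(2) calculation by (simp add: mult_le_cancel_right1)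
  moreover have "k e0 * m e0 \<beta> \<le> 1" using term_le[OF \<open>\<beta> \<in> D\<close>] by simp
  ultimately have "m e0 \<beta> = 1" by linarith
  with off_\<beta> e0(1) show ?thesis by auto
qed

text \<open>The same statement for roots: a simple root that is a sign-coherent integer
  combination of a finite family of positive roots belongs to that family.\<close>
lemma simple_root_in_positive_combination:
  fixes v :: "'a \<Rightarrow> complex ^ 'n" and k :: "'a \<Rightarrow> int"
  assumes base: "root_base R D" and "finite D" and "0 \<notin> R" and "\<beta> \<in> D"
    and "finite S" and pos: "v ` S \<subseteq> positive_roots R D"
    and \<beta>_eq: "\<beta> = (\<Sum>e\<in>S. of_int (k e) *s v e)"
    and k_sign: "(\<forall>e\<in>S. k e \<ge> 0) \<or> (\<forall>e\<in>S. k e \<le> 0)"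
  shows "\<beta> \<in> v ` S"
proof -
  have indep: "vec.independent D" using base by (simp add: root_base_def)
  have "\<forall>e\<in>S. \<exists>m :: complex ^ 'n \<Rightarrow> int.
          v e = (\<Sum>d\<in>D. of_int (m d) *s d) \<and> (\<forall>d\<in>D. m d \<ge> 0)"
    using pos by (auto simp: positive_roots_def)
  then obtain m :: "'a \<Rightarrow> complex ^ 'n \<Rightarrow> int"
    where v_eq: "\<And>e. e \<in> S \<Longrightarrow> v e = (\<Sum>d\<in>D. of_int (m e d) *s d)"
      and m_nonneg: "\<And>e d. e \<in> S \<Longrightarrow> d \<in> D \<Longrightarrow> m e d \<ge> 0"
    by metis
  have v_span: "v e \<in> vec.span D" if "e \<in> S" for e
    using v_eq[OF that] by (simp add: vec.span_sum vec.span_scale vec.span_base)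
  have v_coord: "vec.representation D (v e) d = of_int (m e d)" if "e \<in> S" "d \<in> D" for e d
    using representation_of_combination[OF indep \<open>finite D\<close> that(2)] v_eq[OF that(1)] by simp
  have m_nonzero: "\<exists>d\<in>D. m e d \<noteq> 0" if "e \<in> S" for e
  proof (rule ccontr)
    assume "\<not> (\<exists>d\<in>D. m e d \<noteq> 0)"
    then have "v e = 0" using v_eq[OF that] by simp
    moreover have "v e \<in> R" using pos that by (auto simp: positive_roots_def)
    ultimately show False using \<open>0 \<notin> R\<close> by simp
  qed
  have sum_unit: "(\<Sum>e\<in>S. k e * m e d) = (if d = \<beta> then 1 else 0)" if "d \<in> D" for d
  proof -
    have "(of_int (if d = \<beta> then 1 else 0) :: complex) = vec.representation D \<beta> d"
      using vec.representation_basis[OF indep \<open>\<beta> \<in> D\<close>] by simp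
    also have "\<dots> = (\<Sum>e\<in>S. of_int (k e) * vec.representation D (v e) d)"
      unfolding \<beta>_eq
      by (simp add: vec.representation_sum[OF indep] vec.representation_scale[OF indep]
          v_span vec.span_scale)
    also have "\<dots> = of_int (\<Sum>e\<in>S. k e * m e d)"
      using v_coord \<open>d \<in> D\<close> by simp
    finally show ?thesis by (simp only: of_int_eq_iff)
  qed
  obtain e0 where "e0 \<in> S" and m_unit: "\<forall>d\<in>D. m e0 d = (if d = \<beta> then 1 else 0)"
    using unit_vector_indecomposable[OF \<open>finite S\<close> \<open>\<beta> \<in> D\<close> m_nonneg m_nonzero k_sign sum_unit]
    by blast
  have "v e0 = (\<Sum>d\<in>D. of_int (m e0 d) *s d)" by (rule v_eq[OF \<open>e0 \<in> S\<close>])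
  also have "\<dots> = (\<Sum>d\<in>D. vec.representation D \<beta> d *s d)"
    using m_unit vec.representation_basis[OF indep \<open>\<beta> \<in> D\<close>] by (intro sum.cong) auto
  also have "\<dots> = \<beta>"
    using indep \<open>finite D\<close> \<open>\<beta> \<in> D\<close> by (intro vec.sum_representation_eq) (auto intro: vec.span_base)
  finally show ?thesis using \<open>e0 \<in> S\<close> by (metis image_eqI)
qed

text \<open>A root in the span of the image of a set has a root preimage in the span of the set.\<close>
lemma automorphism_preimage_in_span:
  assumes "root_automorphism R w" and "y \<in> R" and "y \<in> vec.span (w ` S)"
  shows "\<exists>x\<in>R. x \<in> vec.span S \<and> w x = y"
proof -
  have lin: "Vector_Spaces.linear (*s) (*s) w" and "inj w" and "w ` R = R"
    using assms(1) by (auto simp: root_automorphism_def)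
  obtain x where "x \<in> vec.span S" "w x = y"
    using assms(3) vec.linear_span_image[OF lin] by auto
  moreover have "x \<in> R" using \<open>y \<in> R\<close> \<open>w ` R = R\<close> \<open>inj w\<close> \<open>w x = y\<close> by (metis imageE injD)
  ultimately show ?thesis by blast
qed

theorem mainTheorem3:
  fixes R D S0 :: "(complex ^ 'n) set"
    and w :: "complex ^ 'n \<Rightarrow> complex ^ 'n"
    and \<beta> :: "complex ^ 'n"
  assumes "irreducible_root_system R"
    and "reduced_root_system R"
    and "root_base R D"
    and "S0 \<subseteq> D"
    and "w \<in> weyl_group R"
    and "w ` S0 \<subseteq> positive_roots R D"
    and "\<beta> \<in> D"
    and "\<beta> \<notin> w ` S0"
  shows "\<beta> \<notin> vec.span (w ` S0)"
proof
  assume \<beta>_span: "\<beta> \<in> vec.span (w ` S0)"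
  have "root_system R" using assms(1) by (simp add: irreducible_root_system_def)
  then have "finite R" and "0 \<notin> R" by (auto simp: root_system_def)
  have "D \<subseteq> R" using assms(3) by (simp add: root_base_def)
  with \<open>finite R\<close> have "finite D" by (rule finite_subset[rotated])
  with assms(4) have "finite S0" by (rule finite_subset)
  have aut: "root_automorphism R w" using assms(5) by (rule weyl_group_automorphism)
  then have lin: "Vector_Spaces.linear (*s) (*s) w" by (simp add: root_automorphism_def)
  obtain x where "x \<in> R" "x \<in> vec.span S0" "w x = \<beta>"
    using automorphism_preimage_in_span[OF aut _ \<beta>_span] \<open>D \<subseteq> R\<close> assms(7) by blast
  then obtain k :: "complex ^ 'n \<Rightarrow> int" where x_eq: "x = (\<Sum>e\<in>S0. of_int (k e) *s e)"
    and k_sign: "(\<forall>e\<in>S0. k e \<ge> 0) \<or> (\<forall>e\<in>S0. k e \<le> 0)"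
    using root_in_span_of_simple_roots[OF assms(3) \<open>finite D\<close> assms(4)] by blast
  have "\<beta> = (\<Sum>e\<in>S0. of_int (k e) *s w e)"
    using \<open>w x = \<beta>\<close> by (simp add: x_eq vec.linear_sum[OF lin] vec.linear_scale[OF lin])
  then have "\<beta> \<in> w ` S0"
    using simple_root_in_positive_combination[OF assms(3) \<open>finite D\<close> \<open>0 \<notin> R\<close> assms(7)
        \<open>finite S0\<close> assms(6) _ k_sign] by blast
  with assms(8) show False by contradiction
qed

end
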